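(* Let $I_1, I_2 \subseteq \mathbb{R}$ be nonempty open intervals, let $J = \frac12(I_1+I_2)$, and let $\varphi : J \to \mathbb{R}$, $\psi_1 : I_1 \to \mathbb{R}$, $\psi_2 : I_2 \to \mathbb{R}$ be functions such that \[ \varphi\left(\frac{x+y}{2}\right)\bigl(\psi_1(x)-\psi_2(y)\bigr)=0 \qquad \text{for all } x \in I_1 \text{ and } y \in I_2 . \] Suppose that $\varphi$ is Lebesgue measurable. Then exactly one of the following statements is true. (1) $\mu(\operatorname{supp}\varphi)=0$, or there exists $\lambda \in \mathbb{R}$ such that $\psi_1(x)=\psi_2(y)=\lambda$ for all $x \in I_1$ and $y \in I_2$. (2) There exist constants $\lambda,\nu \in \mathbb{R}$ and, for $i=1,2$, there exist $a_i, b_i \in \overline{\mathbb{R}}$ such that $\inf I_i \le a_i \le b_i \le \sup I_i$ and for the open intervals $U_i := \left]\inf I_i, a_i\right[$ and $V_i := \left]b_i, \sup I_i\right[$ the following assertions are fulfilled: - $U_i \ne I_i$ and $V_i \neq I_i$ for $i=1,2$; - $U_1, U_2$ are both nonempty or $V_1, V_2$ are both nonempty; - $\psi_1(x)=\psi_2(y)=\lambda$ for all $(x,y) \in U_1\times U_2$, and $\psi_1(x)=\psi_2(y)=\nu$ for all $(x,y)\in V_1 \times V_2$; - \[ \mu\left(\left(\tfrac12(K_1+I_2) \cup \tfrac12(I_1+K_2)\right)\cap \operatorname{supp}\varphi\right)=0, \] where $K_i := I_i \setminus (U_i \cup V_i)$ is a nonempty subinterval which is closed in $I_i$ ($i=1,2$).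 (3) There exist a constant $\lambda\in\mathbb{R}$ and an index $j \in\{1,2\}$ such that $\psi_j(z)=\lambda$ for all $z \in I_j$, while, for the index $i \in \{1,2\}$ with $i\neq j$, there exists a finite or countable collection of disjoint, nonempty open intervals $U_n \subset I_i$ ($n=1,\dots,N$, where $N\in\mathbb{N}$ or $N=\infty$) such that \[ \bigcup_{n=1}^N U_n \ne I_i, \qquad \psi_i(z)=\lambda \ \text{ for all } z\in \bigcup_{n=1}^N U_n, \] and moreover \[ \varphi(t)=0 \ \text{ for all } t \in \frac12\left(\left(I_i \setminus \bigcup_{n=1}^N U_n\right)+I_j\right). \]
   Context: $\mu$ denotes Lebesgue measure on $\mathbb{R}$ and $\overline{\mathbb{R}} = \mathbb{R}\cup\{-\infty,+\infty\}$. For a real function $f$ on $I$, $\operatorname{supp} f := \{x \in I : f(x)\neq 0\}$ (no closure is taken). For sets $A,B\subseteq\mathbb{R}$, $\frac12(A+B)=\{\frac{a+b}{2} : a\in A,\ b\in B\}$. $\left]\alpha,\beta\right[$ denotes the open interval $\{t \in \mathbb{R}: \alpha<t<\beta\}$ with $\alpha\le\beta$ in $\overline{\mathbb{R}}$; it is empty when $\alpha=\beta$, even if these are infinite.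
   Formalization: "Exactly one" is replaced by "at least one": the alternatives are not mutually exclusive, since for I_1 = I_2 = ℝ and φ, ψ_1, ψ_2 all zero, (1), (2) and (3) all hold, and (2) and (3) can overlap even when (1) fails. *)

theory Defs
  imports "HOL-Analysis.Analysis"
begin

definition open_interval :: "real set \<Rightarrow> bool" where
  "open_interval I \<longleftrightarrow> open I \<and> is_interval I"

definition half_sum :: "real set \<Rightarrow> real set \<Rightarrow> real set" where
  "half_sum A B = {(a + b) / 2 | a b. a \<in> A \<and> b \<in> B}"

definition supp_on :: "real set \<Rightarrow> (real \<Rightarrow> real) \<Rightarrow> real set" where
  "supp_on I f = {x \<in> I. f x \<noteq> 0}"

definition ioo :: "ereal \<Rightarrow> ereal \<Rightarrow> real set" where
  "ioo \<alpha> \<beta> = {t. \<alpha> < ereal t \<and> ereal t < \<beta>}"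

text \<open>
  Infimum and supremum are taken in the extended reals, because the intervals may be unbounded.
\<close>

definition einf :: "real set \<Rightarrow> ereal" where
  "einf I = Inf (ereal ` I)"

definition esup :: "real set \<Rightarrow> ereal" where
  "esup I = Sup (ereal ` I)"

text \<open>
  Vanishing measure is expressed by membership in \<open>null_sets lebesgue\<close>, which also asserts
  measurability; \<open>emeasure\<close> alone would be zero on every non-measurable set.
\<close>

definition alternative1 ::
  "real set \<Rightarrow> real set \<Rightarrow> (real \<Rightarrow> real) \<Rightarrow> (real \<Rightarrow> real) \<Rightarrow> (real \<Rightarrow> real) \<Rightarrow> bool" where
  "alternative1 I1 I2 \<phi> \<psi>1 \<psi>2 \<longleftrightarrow>
     supp_on (half_sum I1 I2) \<phi> \<in> null_sets lebesgue \<or>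
     (\<exists>\<kappa>. \<forall>x\<in>I1. \<forall>y\<in>I2. \<psi>1 x = \<kappa> \<and> \<psi>2 y = \<kappa>)"

definition alternative2 ::
  "real set \<Rightarrow> real set \<Rightarrow> (real \<Rightarrow> real) \<Rightarrow> (real \<Rightarrow> real) \<Rightarrow> (real \<Rightarrow> real) \<Rightarrow> bool" where
  "alternative2 I1 I2 \<phi> \<psi>1 \<psi>2 \<longleftrightarrow>
     (\<exists>(\<kappa>::real) (\<nu>::real) a1 b1 a2 b2.
        einf I1 \<le> a1 \<and> a1 \<le> b1 \<and> b1 \<le> esup I1 \<and>
        einf I2 \<le> a2 \<and> a2 \<le> b2 \<and> b2 \<le> esup I2 \<and>
        (let U1 = ioo (einf I1) a1; V1 = ioo b1 (esup I1); K1 = I1 - (U1 \<union> V1);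
             U2 = ioo (einf I2) a2; V2 = ioo b2 (esup I2); K2 = I2 - (U2 \<union> V2)
         in U1 \<noteq> I1 \<and> V1 \<noteq> I1 \<and> U2 \<noteq> I2 \<and> V2 \<noteq> I2 \<and>
            ((U1 \<noteq> {} \<and> U2 \<noteq> {}) \<or> (V1 \<noteq> {} \<and> V2 \<noteq> {})) \<and>
            (\<forall>x\<in>U1. \<forall>y\<in>U2. \<psi>1 x = \<kappa> \<and> \<psi>2 y = \<kappa>) \<and>
            (\<forall>x\<in>V1. \<forall>y\<in>V2. \<psi>1 x = \<nu> \<and> \<psi>2 y = \<nu>) \<and>
            K1 \<noteq> {} \<and> is_interval K1 \<and> closedin (top_of_set I1) K1 \<and>
            K2 \<noteq> {} \<and> is_interval K2 \<and> closedin (top_of_set I2) K2 \<and>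
            (half_sum K1 I2 \<union> half_sum I1 K2) \<inter> supp_on (half_sum I1 I2) \<phi>
              \<in> null_sets lebesgue))"

text \<open>
  The third alternative for one choice of the two indices: \<open>Ij\<close>, \<open>\<psi>j\<close> carry the constant
  function. The collection is indexed by \<open>1, \<dots>, N\<close>, where \<open>N = \<infinity>\<close> is allowed.
\<close>

definition alternative3_at ::
  "(real \<Rightarrow> real) \<Rightarrow> real set \<Rightarrow> (real \<Rightarrow> real) \<Rightarrow> real set \<Rightarrow> (real \<Rightarrow> real) \<Rightarrow> bool" where
  "alternative3_at \<phi> Ij \<psi>j Ii \<psi>i \<longleftrightarrow>
     (\<exists>(\<kappa>::real) (N::enat) (U :: nat \<Rightarrow> real set).
        (\<forall>z\<in>Ij. \<psi>j z = \<kappa>) \<and> 1 \<le> N \<and>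
        (let idx = {n. 1 \<le> n \<and> enat n \<le> N}
         in (\<forall>n\<in>idx. open_interval (U n) \<and> U n \<noteq> {} \<and> U n \<subseteq> Ii) \<and>
            disjoint_family_on U idx \<and>
            (\<Union>n\<in>idx. U n) \<noteq> Ii \<and>
            (\<forall>z\<in>(\<Union>n\<in>idx. U n). \<psi>i z = \<kappa>) \<and>
            (\<forall>t\<in>half_sum (Ii - (\<Union>n\<in>idx. U n)) Ij. \<phi> t = 0)))"

definition alternative3 ::
  "real set \<Rightarrow> real set \<Rightarrow> (real \<Rightarrow> real) \<Rightarrow> (real \<Rightarrow> real) \<Rightarrow> (real \<Rightarrow> real) \<Rightarrow> bool" where
  "alternative3 I1 I2 \<phi> \<psi>1 \<psi>2 \<longleftrightarrow>
     alternative3_at \<phi> I1 \<psi>1 I2 \<psi>2 \<or> alternative3_at \<phi> I2 \<psi>2 I1 \<psi>1"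

text \<open>
  The alternatives are not mutually exclusive, even under the hypotheses of the main theorem: all
  three hold for zero functions, and the last two can overlap when the first one fails. Hence only
  their disjunction can be asserted. The two examples follow.
\<close>

lemma all_alternatives_hold:
  fixes z :: "real \<Rightarrow> real"
  assumes z: "z = (\<lambda>_. 0)"
  shows "alternative1 UNIV UNIV z z z \<and> alternative2 UNIV UNIV z z z \<and> alternative3 UNIV UNIV z z z"
proof (intro conjI)
  have supp: "supp_on A (\<lambda>_. 0) = {}" for A
    by (simp add: supp_on_def)
  have inf: "einf UNIV = - \<infinity>"
    unfolding einf_def
    by (rule ereal_bot, rule Inf_lower, rule imageI, simp)
  have sup: "esup UNIV = \<infinity>"
    unfolding esup_def
    by (rule ereal_top, rule Sup_upper, rule imageI, simp)
  have U: "ioo (- \<infinity>) 0 = {..<0}" and V: "ioo 0 \<infinity> = {0<..}"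
    by (auto simp: ioo_def)
  have K: "UNIV - ({..<0} \<union> {0<..}) = {0::real}"
    by auto
  have ne: "{..<0} \<noteq> (UNIV::real set)" "{0<..} \<noteq> (UNIV::real set)"
    by (metis UNIV_I lessThan_iff less_irrefl) (metis UNIV_I greaterThan_iff less_irrefl)
  show "alternative1 UNIV UNIV z z z"
    by (simp add: alternative1_def z supp)
  show "alternative2 UNIV UNIV z z z"
    unfolding alternative2_def Let_def inf sup
    by (rule exI[of _ 0], rule exI[of _ 0], (rule exI[of _ "0::ereal"])+)
      (simp add: U V K ne supp z is_interval_cc[of 0 0, simplified])
  have "alternative3_at z UNIV z UNIV z"
    unfolding alternative3_at_def Let_def
    by (rule exI[of _ 0], rule exI[of _ 1], rule exI[of _ "\<lambda>_. {..<0}"])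
      (auto simp: open_interval_def disjoint_family_on_def z one_enat_def is_interval_io)
  then show "alternative3 UNIV UNIV z z z"
    by (simp add: alternative3_def)
qed

lemma alternatives_2_3_overlap:
  fixes I :: "real set" and \<phi> \<psi>1 \<psi>2 :: "real \<Rightarrow> real"
  assumes I: "I = {0<..}"
    and \<phi>: "\<phi> = (\<lambda>t. if t \<le> 1/2 then 1 else 0)"
    and \<psi>1: "\<psi>1 = (\<lambda>_. 0)"
    and \<psi>2: "\<psi>2 = (\<lambda>y. if y < 1 then 0 else 1)"
  shows "\<And>x y. x \<in> I \<Longrightarrow> y \<in> I \<Longrightarrow> \<phi> ((x + y) / 2) * (\<psi>1 x - \<psi>2 y) = 0"
    and "\<phi> \<in> borel_measurable (lebesgue_on (half_sum I I))"
    and "\<not> alternative1 I I \<phi> \<psi>1 \<psi>2"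
    and "alternative2 I I \<phi> \<psi>1 \<psi>2"
    and "alternative3 I I \<phi> \<psi>1 \<psi>2"
proof -
  show "\<phi> ((x + y) / 2) * (\<psi>1 x - \<psi>2 y) = 0" if "x \<in> I" "y \<in> I" for x y
    using that by (auto simp: I \<phi> \<psi>1 \<psi>2)
  have "\<phi> \<in> borel_measurable borel"
    unfolding \<phi> by measurable
  then have "\<phi> \<in> borel_measurable lebesgue"
    by (simp add: measurable_completion)
  then show "\<phi> \<in> borel_measurable (lebesgue_on (half_sum I I))"
    by (rule measurable_restrict_space1)
  have J: "half_sum I I = I"
  proof (intro equalityI subsetI)
    fix x assume "x \<in> I"
    then show "x \<in> half_sum I I"
      unfolding half_sum_def by (intro CollectI exI[of _ x]) auto
  qed (auto simp: half_sum_def I)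
  have inf: "einf I = 0"
    unfolding einf_def
  proof (rule Inf_eqI)
    fix y :: ereal assume y: "\<And>i. i \<in> ereal ` I \<Longrightarrow> y \<le> i"
    show "y \<le> 0"
    proof (rule ereal_le_epsilon2)
      show "y \<le> 0 + ereal e" if "0 < e" for e
        using y that by (simp add: I)
    qed
  qed (auto simp: I)
  have sup: "esup I = \<infinity>"
    unfolding esup_def
  proof (rule ereal_top)
    fix b :: real
    have "ereal b \<le> ereal (max 1 b)" by simp
    also have "\<dots> \<le> Sup (ereal ` I)" by (rule Sup_upper, rule imageI) (simp add: I)
    finally show "ereal b \<le> Sup (ereal ` I)" .
  qed
  have U: "ioo 0 1 = {0<..<1}" and V: "ioo \<infinity> \<infinity> = {}"
    by (auto simp: ioo_def)
  have K: "I - {0<..<1} = {1..}"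
    by (auto simp: I)
  have ne: "{0<..<1} \<noteq> I" "I \<noteq> {}"
    using K by (auto simp: I)
  have half: "t > 1/2" if "t \<in> half_sum {1..} I \<or> t \<in> half_sum I {1..}" for t
    using that by (auto simp: half_sum_def I)
  have supp: "supp_on I \<phi> = {0<..1/2}"
    by (auto simp: supp_on_def I \<phi>)
  have "emeasure lebesgue {0<..1/2::real} \<noteq> 0"
    by simp
  then have "supp_on I \<phi> \<notin> null_sets lebesgue"
    unfolding supp by blast
  moreover have "\<psi>2 (1/2) \<noteq> \<psi>2 2" "1/2 \<in> I" "2 \<in> I"
    by (auto simp: \<psi>2 I)
  ultimately show "\<not> alternative1 I I \<phi> \<psi>1 \<psi>2"
    unfolding alternative1_def J by metis
  have disj: "(half_sum {1..} I \<union> half_sum I {1..}) \<inter> {0<..1/2} = {}"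
    using half by fastforce
  have closed: "closedin (top_of_set I) {1..}"
    by (rule closed_subset) (auto simp: I)
  show "alternative2 I I \<phi> \<psi>1 \<psi>2"
    unfolding alternative2_def Let_def inf sup
    by (rule exI[of _ 0], rule exI[of _ 0], rule exI[of _ 1], rule exI[of _ "\<infinity>"],
        rule exI[of _ 1], rule exI[of _ "\<infinity>"])
      (simp add: U V K J ne ne(2)[symmetric] supp disj closed is_interval_ci \<psi>1 \<psi>2)
  have idx: "{n. 1 \<le> n \<and> enat n \<le> 1} = {1}"
    by (auto simp: one_enat_def)
  have zero: "\<phi> t = 0" if "t \<in> half_sum {1..} I" for t
    using half[of t] that by (simp add: \<phi>)
  have sub: "{0<..<1} \<subseteq> I"
    by (auto simp: I)
  have "alternative3_at \<phi> I \<psi>1 I \<psi>2"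
    unfolding alternative3_at_def Let_def
    by (rule exI[of _ 0], rule exI[of _ 1], rule exI[of _ "\<lambda>_. {0<..<1}"], unfold idx)
      (use ne sub zero in \<open>auto simp: K open_interval_def disjoint_family_on_def \<psi>1 \<psi>2 is_interval_oo\<close>)
  then show "alternative3 I I \<phi> \<psi>1 \<psi>2"
    by (simp add: alternative3_def)
qed

end

theory Submission
  imports Defs
begin

text \<open>
  On the line \<open>x + y = 2 u\<close> with \<open>\<phi> u \<noteq> 0\<close> one has \<open>\<psi>1 x = \<psi>2 y\<close>. Let \<open>D\<close> be the set of points of
  \<open>J\<close> all of whose neighbourhoods meet \<open>supp \<phi>\<close> in a set of positive measure. Near a point \<open>t\<close> of
  \<open>D\<close>, Steinhaus' theorem provides pairs of such lines at every sufficiently small distance, so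
  \<open>\<psi>1\<close> and \<open>\<psi>2\<close> are locally constant, hence constant with the same value, on the projections of
  \<open>{(x, y) \<in> I1 \<times> I2. x + y = 2 t}\<close>. By Lindelof \<open>supp \<phi> - D\<close> is null. If the projections to one
  axis cover the whole interval, the third alternative (or the first) results, with the components
  of the complement of the closure of \<open>{x. \<psi>i x \<noteq> \<kappa>}\<close> as the \<open>U n\<close>. Otherwise every such segment cuts
  off a corner of \<open>I1 \<times> I2\<close>, and the unions of the projections for the two kinds of corners are the
  \<open>U i\<close> and \<open>V i\<close> of the second alternative.
\<close>

section \<open>Steinhaus' theorem for sets of positive measure\<close>

text \<open>Take a compact subset \<open>T\<close> of positive measure and an open \<open>W\<close>
  around it of less than twice its measure. A small translate of \<open>T\<close> stays inside
  \<open>W\<close>, so it has no room to be disjoint from \<open>T\<close>.\<close>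

theorem steinhaus_translation:
  fixes A :: "'a::euclidean_space set"
  assumes A: "A \<in> sets lebesgue" and pos: "A \<notin> null_sets lebesgue"
  obtains e where "e > 0" "\<And>d. norm d < e \<Longrightarrow> \<exists>u\<in>A. d + u \<in> A"
proof -
  \<comment> \<open>\<open>A\<close> may have infinite measure; a bounded piece that is not null
    allows measures to be subtracted below.\<close>
  have "\<exists>n::nat. A \<inter> cball 0 (real n) \<notin> null_sets lebesgue"
  proof (rule ccontr)
    assume "\<not> ?thesis"
    then have "(\<Union>n::nat. A \<inter> cball 0 (real n)) \<in> null_sets lebesgue"
      by blast
    moreover have "(\<Union>n::nat. A \<inter> cball 0 (real n)) = A"
      by (auto intro: real_arch_simple)
    ultimately show False
      using pos by simp
  qed
  then obtain n :: nat where n: "A \<inter> cball 0 (real n) \<notin> null_sets lebesgue"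
    by blast
  define B where "B = A \<inter> cball 0 (real n)"
  have B: "B \<in> lmeasurable" "bounded B"
  proof -
    show "bounded B"
      unfolding B_def by (meson bounded_cball bounded_subset inf_le2)
    then show "B \<in> lmeasurable"
      using A unfolding B_def by (intro bounded_set_imp_lmeasurable) auto
  qed
  with n have "measure lebesgue B > 0"
    unfolding B_def by (simp add: negligible_iff_null_sets[symmetric] negligible_iff_measure zero_less_measure_iff)
  \<comment> \<open>An error below the measure of \<open>B\<close> leaves \<open>T\<close> with
    positive measure; in the same way, an error below the measure of \<open>T\<close> makes
    \<open>W\<close> smaller than twice \<open>T\<close>.\<close>
  then obtain T where T: "closed T" "T \<subseteq> B" "emeasure lebesgue (B - T) < ennreal (measure lebesgue B)"
    using sets_lebesgue_inner_closed[of B] B by (metis fmeasurableD)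
  have cT: "compact T"
    using T B by (meson bounded_subset compact_eq_bounded_closed)
  then have lT: "T \<in> lmeasurable"
    by (rule lmeasurable_compact)
  have "measure lebesgue (B - T) < measure lebesgue B"
    using T(3) B lT by (simp add: emeasure_eq_measure2 fmeasurable.Diff ennreal_less_iff)
  moreover have "measure lebesgue (B - T) = measure lebesgue B - measure lebesgue T"
    using B lT T by (intro measurable_measure_Diff) auto
  ultimately have posT: "measure lebesgue T > 0"
    by simp
  obtain W where W: "open W" "T \<subseteq> W" "W - T \<in> lmeasurable"
    "emeasure lebesgue (W - T) < ennreal (measure lebesgue T)"
    using sets_lebesgue_outer_open[of T] lT posT by (metis fmeasurableD)
  have lW: "W \<in> lmeasurable"
    using fmeasurable.Un[OF W(3) lT] W(2) by (simp add: Un_absorb2)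
  have "measure lebesgue (W - T) < measure lebesgue T"
    using W by (simp add: emeasure_eq_measure2 ennreal_less_iff)
  moreover have "measure lebesgue (W - T) = measure lebesgue W - measure lebesgue T"
    using W lT lW by (intro measurable_measure_Diff) auto
  ultimately have mW: "measure lebesgue W < 2 * measure lebesgue T"
    by simp
  have "closed (- W)" "T \<inter> - W = {}"
    using W by auto
  then obtain e where e: "e > 0" "\<And>x y. x \<in> T \<Longrightarrow> y \<in> - W \<Longrightarrow> e \<le> dist x y"
    using separate_compact_closed[OF cT] by meson
  show ?thesis
  proof
    show "e > 0" by fact
    fix d :: 'a assume d: "norm d < e"
    have sub: "(+) d ` T \<subseteq> W"
    proof clarify
      fix x assume "x \<in> T"
      then have "dist x (d + x) < e \<and> x \<in> T"
        using d by (simp add: dist_norm)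
      then show "d + x \<in> W"
        using e(2)[of x "d + x"] by force
    qed
    have "T \<inter> (+) d ` T \<noteq> {}"
    proof
      assume disj: "T \<inter> (+) d ` T = {}"
      have "measure lebesgue (T \<union> (+) d ` T) = measure lebesgue T + measure lebesgue T"
        using disj lT by (simp add: measure_Un2 measurable_translation measure_translation Diff_triv
            Int_commute measure_Un3)
      moreover have "measure lebesgue (T \<union> (+) d ` T) \<le> measure lebesgue W"
        using sub W(2) lT lW by (intro measure_mono_fmeasurable) (auto intro: measurable_translation fmeasurableD)
      ultimately show False
        using mW by simp
    qed
    then show "\<exists>u\<in>A. d + u \<in> A"
      using T(2) unfolding B_def by blast
  qed
qed

section \<open>Points of locally positive measure\<close>

text \<open>For measurable \<open>E\<close> this is the support of Lebesgue measure restricted to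
  \<open>E\<close>. Its points need not belong to \<open>E\<close>.\<close>

definition essential_supp :: "'a::euclidean_space set \<Rightarrow> 'a set" where
  "essential_supp E = {t. \<forall>W. open W \<longrightarrow> t \<in> W \<longrightarrow> E \<inter> W \<notin> null_sets lebesgue}"

text \<open>Every point in question lies in a member of \<open>\<F>\<close>, and by Lindelof
  countably many members have the same union.\<close>

lemma null_outside_essential_supp: "E - essential_supp E \<in> null_sets lebesgue"
proof -
  define \<F> where "\<F> = {W. open W \<and> E \<inter> W \<in> null_sets lebesgue}"
  obtain \<F>' where F: "\<F>' \<subseteq> \<F>" "countable \<F>'" "\<Union>\<F>' = \<Union>\<F>"
    using Lindelof[of \<F>] unfolding \<F>_def by blast
  have "(\<Union>W\<in>\<F>'. E \<inter> W) \<in> null_sets lebesgue"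
    using F unfolding \<F>_def by (intro null_sets_UN') auto
  moreover have "E - essential_supp E \<subseteq> (\<Union>W\<in>\<F>'. E \<inter> W)"
  proof
    fix t assume t: "t \<in> E - essential_supp E"
    then have "t \<in> \<Union>\<F>"
      unfolding \<F>_def essential_supp_def by auto
    then show "t \<in> (\<Union>W\<in>\<F>'. E \<inter> W)"
      using t F(3) by auto
  qed
  ultimately show ?thesis
    by (meson negligible_iff_null_sets negligible_subset)
qed

section \<open>Projections of segments to the axes\<close>

text \<open>
  \<open>slice I1 I2 t\<close> and \<open>slice I2 I1 t\<close> are the projections to the two axes of
  the part of the line \<open>x + y = 2 t\<close> inside \<open>I1 \<times> I2\<close>.
\<close>

definition slice :: "real set \<Rightarrow> real set \<Rightarrow> real \<Rightarrow> real set" where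
  "slice I1 I2 t = {x \<in> I1. 2 * t - x \<in> I2}"

lemma slice_subset: "slice I1 I2 t \<subseteq> I1"
  by (auto simp: slice_def)

lemma mem_slice_swap: "x \<in> slice I1 I2 t \<Longrightarrow> 2 * t - x \<in> slice I2 I1 t"
  by (auto simp: slice_def)

lemma open_slice:
  assumes "open I1" "open I2"
  shows "open (slice I1 I2 t)"
proof -
  have "slice I1 I2 t = I1 \<inter> (\<lambda>x. 2 * t - x) -` I2"
    by (auto simp: slice_def)
  then show ?thesis
    using assms by (auto intro!: open_Int open_vimage continuous_intros)
qed

lemma is_interval_slice:
  assumes "is_interval I1" "is_interval I2"
  shows "is_interval (slice I1 I2 t)"
  unfolding is_interval_1
proof (intro ballI allI impI)
  fix a b x assume ab: "a \<in> slice I1 I2 t" "b \<in> slice I1 I2 t" "a \<le> x \<and> x \<le> b"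
  then have "x \<in> I1"
    using assms(1) unfolding slice_def by (blast intro: mem_is_interval_1_I)
  moreover have "2 * t - x \<in> I2"
    using ab assms(2) mem_is_interval_1_I[of I2 "2 * t - b" "2 * t - a" "2 * t - x"]
    unfolding slice_def by auto
  ultimately show "x \<in> slice I1 I2 t"
    by (simp add: slice_def)
qed

lemma mem_slice_midpoint:
  assumes "x \<in> I1" "y \<in> I2"
  shows "x \<in> slice I1 I2 ((x + y) / 2)" "y \<in> slice I2 I1 ((x + y) / 2)"
  using assms by (auto simp: slice_def field_simps)

lemma slice_eq_empty_iff: "slice I1 I2 t = {} \<longleftrightarrow> t \<notin> half_sum I1 I2"
proof -
  have "t \<in> half_sum I1 I2" if "x \<in> slice I1 I2 t" for x
    using that unfolding slice_def half_sum_def by (intro CollectI exI[of _ x] exI[of _ "2 * t - x"]) auto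
  then show ?thesis
    using mem_slice_midpoint unfolding half_sum_def by blast
qed

lemma half_sum_commute: "half_sum A B = half_sum B A"
  unfolding half_sum_def by (metis add.commute)

lemma open_half_sum:
  assumes "open A"
  shows "open (half_sum A B)"
proof -
  have "half_sum A B = (\<Union>b\<in>B. (\<lambda>t. 2 * t - b) -` A)"
  proof (intro equalityI subsetI)
    fix t assume "t \<in> (\<Union>b\<in>B. (\<lambda>t. 2 * t - b) -` A)"
    then obtain b where "b \<in> B" "2 * t - b \<in> A"
      by blast
    then show "t \<in> half_sum A B"
      unfolding half_sum_def by (intro CollectI exI[of _ "2 * t - b"] exI[of _ b]) auto
  next
    fix t assume "t \<in> half_sum A B"
    then obtain a b where "a \<in> A" "b \<in> B" "t = (a + b) / 2"
      by (auto simp: half_sum_def)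
    then show "t \<in> (\<Union>b\<in>B. (\<lambda>t. 2 * t - b) -` A)"
      by (intro UN_I[of b]) (auto simp: field_simps)
  qed
  then show ?thesis
    using assms by (auto intro!: open_vimage continuous_intros)
qed

section \<open>Constancy along segments through the essential support\<close>

text \<open>If \<open>u\<close> and \<open>v\<close> lie in \<open>E\<close> and
  \<open>v - u = (z - x) / 2\<close>, the lines of \<open>u\<close> and \<open>v\<close> have the
  same height \<open>y\<close> over \<open>x\<close> and \<open>z\<close> respectively, so \<psi>1
  takes the value \<open>\<psi>2 y\<close> at both points. Steinhaus' theorem supplies such a pair
  for every \<open>z\<close> near \<open>x\<close>.\<close>

lemma locally_const_at_essential_supp:
  fixes \<psi>1 \<psi>2 :: "real \<Rightarrow> 'b"
  assumes E: "E \<in> sets lebesgue" and t: "t \<in> essential_supp E"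
    and I: "open I1" "open I2"
    and eq: "\<And>u x. u \<in> E \<Longrightarrow> x \<in> slice I1 I2 u \<Longrightarrow> \<psi>1 x = \<psi>2 (2 * u - x)"
    and x: "x \<in> slice I1 I2 t"
  shows "\<exists>\<eta>>0. \<forall>z. \<bar>z - x\<bar> < \<eta> \<longrightarrow> \<psi>1 z = \<psi>1 x"
proof -
  \<comment> \<open>Restricting \<open>E\<close> to \<open>W\<close> guarantees that the line of
    \<open>u\<close> passes over \<open>x\<close> at a height in \<open>I2\<close>.\<close>
  define W where "W = (\<lambda>u. 2 * u - x) -` I2"
  have W: "open W" "t \<in> W"
    unfolding W_def using I x by (auto intro!: open_vimage continuous_intros simp: slice_def)
  then have "E \<inter> W \<in> sets lebesgue" "E \<inter> W \<notin> null_sets lebesgue"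
    using t E by (auto simp: essential_supp_def)
  then obtain e where e: "e > 0" "\<And>d. norm d < e \<Longrightarrow> \<exists>u\<in>E \<inter> W. d + u \<in> E \<inter> W"
    using steinhaus_translation by blast
  obtain r where r: "r > 0" "ball x r \<subseteq> I1"
    using I x by (auto simp: slice_def open_contains_ball)
  show ?thesis
  proof (intro exI[of _ "min e r"] conjI allI impI)
    show "min e r > 0"
      using e r by simp
    fix z assume z: "\<bar>z - x\<bar> < min e r"
    then have zI: "z \<in> I1"
      using r(2) by (auto simp: dist_real_def abs_minus_commute subset_iff)
    have "q / 2 < e" if "q < e" for q
      using e(1) that by simp
    then have "\<bar>z - x\<bar> / 2 < e"
      using z by simp
    then have "norm ((z - x) / 2) < e"
      by (simp only: real_norm_def abs_divide abs_numeral)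
    then obtain u where u: "u \<in> E" "u \<in> W" "(z - x) / 2 + u \<in> E"
      using e(2) by blast
    define v where "v = (z - x) / 2 + u"
    have vz: "2 * v - z = 2 * u - x"
      by (simp add: v_def field_simps)
    have "v \<in> E" "z \<in> slice I1 I2 v"
      using u zI by (simp_all add: v_def[symmetric] slice_def vz W_def)
    then have "\<psi>1 z = \<psi>2 (2 * v - z)"
      by (rule eq)
    moreover have "\<psi>1 x = \<psi>2 (2 * u - x)"
      using u x by (intro eq) (auto simp: slice_def W_def)
    ultimately show "\<psi>1 z = \<psi>1 x"
      by (simp add: vz)
  qed
qed

text \<open>Connectedness gives constancy of \<psi>1 on its slice. Since \<open>t\<close> itself
  need not lie in \<open>E\<close>, the values of \<psi>1 and \<psi>2 are compared on the line of a
  nearby \<open>u\<close> in \<open>E\<close>, and local constancy of \<psi>2 absorbs the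
  shift.\<close>

lemma const_on_slices:
  fixes \<psi>1 \<psi>2 :: "real \<Rightarrow> 'b"
  assumes E: "E \<in> sets lebesgue" and t: "t \<in> essential_supp E"
    and I: "open_interval I1" "open_interval I2"
    and eq: "\<And>u x. u \<in> E \<Longrightarrow> x \<in> slice I1 I2 u \<Longrightarrow> \<psi>1 x = \<psi>2 (2 * u - x)"
  shows "\<exists>k. (\<forall>x\<in>slice I1 I2 t. \<psi>1 x = k) \<and> (\<forall>y\<in>slice I2 I1 t. \<psi>2 y = k)"
proof -
  have o: "open I1" "open I2" and i: "is_interval I1" "is_interval I2"
    using I by (auto simp: open_interval_def)
  have eq': "\<psi>2 y = \<psi>1 (2 * u - y)" if "u \<in> E" "y \<in> slice I2 I1 u" for u y
    using eq[OF that(1) mem_slice_swap[OF that(2)]] by simp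
  have const1: "\<psi>1 x = \<psi>1 z" if xz: "x \<in> slice I1 I2 t" "z \<in> slice I1 I2 t" for x z
  proof (rule connected_local_const[OF _ xz])
    show "connected (slice I1 I2 t)"
      using i is_interval_slice is_interval_connected_1 by blast
    show "\<forall>a\<in>slice I1 I2 t. \<forall>\<^sub>F b in at a within slice I1 I2 t. \<psi>1 a = \<psi>1 b"
    proof
      fix a assume "a \<in> slice I1 I2 t"
      with E t o eq have "\<exists>\<eta>>0. \<forall>z. \<bar>z - a\<bar> < \<eta> \<longrightarrow> \<psi>1 z = \<psi>1 a"
        by (rule locally_const_at_essential_supp)
      then obtain \<eta> where \<eta>: "\<eta> > 0" "\<And>z. \<bar>z - a\<bar> < \<eta> \<Longrightarrow> \<psi>1 z = \<psi>1 a"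
        by blast
      then show "\<forall>\<^sub>F b in at a within slice I1 I2 t. \<psi>1 a = \<psi>1 b"
        unfolding eventually_at by (metis dist_real_def)
    qed
  qed
  have transfer: "\<psi>2 y = \<psi>1 (2 * t - y)" if y: "y \<in> slice I2 I1 t" for y
  proof -
    have "\<exists>\<eta>>0. \<forall>z. \<bar>z - y\<bar> < \<eta> \<longrightarrow> \<psi>2 z = \<psi>2 y"
      using E t o(2,1) eq' y by (rule locally_const_at_essential_supp)
    then obtain \<eta> where \<eta>: "\<eta> > 0" "\<And>z. \<bar>z - y\<bar> < \<eta> \<Longrightarrow> \<psi>2 z = \<psi>2 y"
      by blast
    \<comment> \<open>Passing from \<open>t\<close> to \<open>u\<close> moves the height over
      \<open>2 * t - y\<close> from \<open>y\<close> to \<open>y + 2 * (u - t)\<close>, hence the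
      radius \<open>\<eta> / 2\<close>; the second factor keeps this height in
      \<open>I2\<close>.\<close>
    define W where "W = ball t (\<eta> / 2) \<inter> (\<lambda>u. 2 * u - (2 * t - y)) -` I2"
    have "open W"
      unfolding W_def using o by (auto intro!: open_Int open_vimage continuous_intros)
    moreover have "t \<in> W"
      using \<eta>(1) y by (auto simp: W_def slice_def)
    ultimately have "E \<inter> W \<noteq> {}"
      using t null_sets.empty_sets unfolding essential_supp_def by fastforce
    then obtain u where u: "u \<in> E" "u \<in> W"
      by blast
    have "\<psi>1 (2 * t - y) = \<psi>2 (2 * u - (2 * t - y))"
      using u y by (intro eq) (auto simp: slice_def W_def)
    also have "\<dots> = \<psi>2 y"
      using u(2) by (intro \<eta>(2)) (auto simp: W_def dist_real_def abs_if split: if_splits)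
    finally show ?thesis ..
  qed
  show ?thesis
  proof (cases "slice I1 I2 t = {}")
    case True
    then show ?thesis
      using mem_slice_swap by blast
  next
    case False
    then obtain p where "p \<in> slice I1 I2 t"
      by blast
    then show ?thesis
      using const1 transfer mem_slice_swap by (intro exI[of _ "\<psi>1 p"]) metis
  qed
qed

section \<open>Initial and final segments of an interval\<close>

text \<open>A relative down-set, with inclusion in \<open>I\<close> assumed separately. Unions
  preserve the property, so the corners cut off by different lines can be merged.\<close>

definition initial_in :: "real set \<Rightarrow> real set \<Rightarrow> bool" where
  "initial_in I U \<longleftrightarrow> (\<forall>x\<in>U. \<forall>z\<in>I. z \<le> x \<longrightarrow> z \<in> U)"

definition final_in :: "real set \<Rightarrow> real set \<Rightarrow> bool" where
  "final_in I V \<longleftrightarrow> (\<forall>x\<in>V. \<forall>z\<in>I. x \<le> z \<longrightarrow> z \<in> V)"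

lemma einf_less_open:
  assumes "open S" "x \<in> S"
  shows "einf S < ereal x"
proof -
  obtain r where r: "r > 0" "ball x r \<subseteq> S"
    using assms by (auto simp: open_contains_ball)
  then have "x - r / 2 \<in> S"
    by (auto simp: subset_iff dist_real_def)
  then have "einf S \<le> ereal (x - r / 2)"
    unfolding einf_def by (intro Inf_lower) auto
  also have "\<dots> < ereal x"
    using r by simp
  finally show ?thesis .
qed

lemma less_esup_open:
  assumes "open S" "x \<in> S"
  shows "ereal x < esup S"
proof -
  obtain r where r: "r > 0" "ball x r \<subseteq> S"
    using assms by (auto simp: open_contains_ball)
  then have "x + r / 2 \<in> S"
    by (auto simp: subset_iff dist_real_def)
  then have "ereal (x + r / 2) \<le> esup S"
    unfolding esup_def by (intro Sup_upper) auto
  moreover have "ereal x < ereal (x + r / 2)"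
    using r by simp
  ultimately show ?thesis
    by (rule less_le_trans[rotated])
qed

lemma einf_less_iff: "einf S < a \<longleftrightarrow> (\<exists>x\<in>S. ereal x < a)"
  by (auto simp: einf_def Inf_less_iff)

lemma less_esup_iff: "a < esup S \<longleftrightarrow> (\<exists>x\<in>S. a < ereal x)"
  by (auto simp: esup_def less_Sup_iff)

text \<open>
  \<open>esup {}\<close> is \<open>-\<infinity>\<close>, hence the maximum; likewise the minimum in the next lemma.
\<close>

lemma initial_in_eq_ioo:
  assumes I: "is_interval I" and U: "open U" "U \<subseteq> I" "initial_in I U"
  shows "ioo (einf I) (max (einf I) (esup U)) = U"
proof (intro equalityI subsetI)
  fix x assume "x \<in> ioo (einf I) (max (einf I) (esup U))"
  then have "einf I < ereal x" "ereal x < esup U"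
    by (auto simp: ioo_def less_max_iff_disj)
  then obtain i u where iu: "i \<in> I" "i < x" "u \<in> U" "x < u"
    by (auto simp: einf_less_iff less_esup_iff)
  then have "x \<in> I"
    using U I mem_is_interval_1_I[of I i u x] by auto
  then show "x \<in> U"
    using iu U(3) by (auto simp: initial_in_def)
next
  fix x assume x: "x \<in> U"
  then have "einf I \<le> einf U"
    unfolding einf_def using U by (intro Inf_superset_mono image_mono)
  then show "x \<in> ioo (einf I) (max (einf I) (esup U))"
    using einf_less_open[OF U(1) x] less_esup_open[OF U(1) x]
    by (auto simp: ioo_def less_max_iff_disj)
qed

lemma final_in_eq_ioo:
  assumes I: "is_interval I" and V: "open V" "V \<subseteq> I" "final_in I V"
  shows "ioo (min (esup I) (einf V)) (esup I) = V"
proof (intro equalityI subsetI)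
  fix x assume "x \<in> ioo (min (esup I) (einf V)) (esup I)"
  then have "ereal x < esup I" "einf V < ereal x"
    by (auto simp: ioo_def min_less_iff_disj)
  then obtain i v where iv: "i \<in> I" "x < i" "v \<in> V" "v < x"
    by (auto simp: einf_less_iff less_esup_iff)
  then have "x \<in> I"
    using V I mem_is_interval_1_I[of I v i x] by auto
  then show "x \<in> V"
    using iv V(3) by (auto simp: final_in_def)
next
  fix x assume x: "x \<in> V"
  then have "esup V \<le> esup I"
    unfolding esup_def using V by (intro Sup_subset_mono image_mono)
  then show "x \<in> ioo (min (esup I) (einf V)) (esup I)"
    using einf_less_open[OF V(1) x] less_esup_open[OF V(1) x]
    by (auto simp: ioo_def min_less_iff_disj)
qed

text \<open>This supplies the endpoints in the second alternative. A point of \<open>I\<close>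
  outside both sets has all of \<open>U\<close> to its left and all of \<open>V\<close> to its
  right, which gives \<open>a \<le> b\<close>.\<close>

lemma two_ended_complement:
  assumes I: "open_interval I" "I \<noteq> {}"
    and U: "open U" "U \<subseteq> I" "initial_in I U"
    and V: "open V" "V \<subseteq> I" "final_in I V"
    and K: "I - (U \<union> V) \<noteq> {}"
  obtains a b where "einf I \<le> a" "a \<le> b" "b \<le> esup I"
    "ioo (einf I) a = U" "ioo b (esup I) = V"
    "is_interval (I - (U \<union> V))" "closedin (top_of_set I) (I - (U \<union> V))"
proof
  let ?a = "max (einf I) (esup U)" and ?b = "min (esup I) (einf V)"
  have i: "is_interval I" and o: "open I"
    using I by (auto simp: open_interval_def)
  show "einf I \<le> ?a" "?b \<le> esup I"
    by auto
  obtain p where p: "p \<in> I" "p \<notin> U" "p \<notin> V"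
    using K by blast
  have UV: "x < y" if "x \<in> U" "y \<in> V" for x y
    using that p U(3) V(3) unfolding initial_in_def final_in_def by (meson not_le order.strict_trans)
  have "einf I \<le> esup I"
    using einf_less_open[OF o p(1)] less_esup_open[OF o p(1)] by auto
  moreover have "einf I \<le> einf V"
    unfolding einf_def using V by (intro Inf_superset_mono image_mono)
  moreover have "esup U \<le> esup I"
    unfolding esup_def using U by (intro Sup_subset_mono image_mono)
  moreover have "esup U \<le> einf V"
    unfolding esup_def einf_def using UV by (intro Sup_least Inf_greatest) (auto intro: less_imp_le)
  ultimately show "?a \<le> ?b"
    by simp
  show "ioo (einf I) ?a = U" "ioo ?b (esup I) = V"
    by (rule initial_in_eq_ioo[OF i U], rule final_in_eq_ioo[OF i V])
  show "is_interval (I - (U \<union> V))"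
    unfolding is_interval_1
  proof (intro ballI allI impI)
    fix x z y assume xz: "x \<in> I - (U \<union> V)" "z \<in> I - (U \<union> V)" "x \<le> y \<and> y \<le> z"
    then have "y \<in> I"
      using mem_is_interval_1_I[OF i, of x z y] by blast
    then show "y \<in> I - (U \<union> V)"
      using xz U(3) V(3) unfolding initial_in_def final_in_def by blast
  qed
  have "closedin (top_of_set I) (I \<inter> - (U \<union> V))"
    using U V by (intro closedin_closed_Int) auto
  then show "closedin (top_of_set I) (I - (U \<union> V))"
    by (simp add: Diff_eq)
qed

section \<open>Corners cut off by a line\<close>

text \<open>The number \<open>y\<close> is a height in \<open>I2\<close> that stays below the line
  over all of \<open>I1\<close>. To the right of a point of the slice the line descends but remains
  above \<open>y\<close>, hence inside the interval \<open>I2\<close>.\<close>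

lemma final_in_slice:
  assumes "is_interval I2" "y \<in> I2" "\<And>x. x \<in> I1 \<Longrightarrow> x + y < 2 * t"
  shows "final_in I1 (slice I1 I2 t)"
  unfolding final_in_def
proof (intro ballI impI)
  fix x z assume xz: "x \<in> slice I1 I2 t" "z \<in> I1" "x \<le> z"
  then have "y \<le> 2 * t - z" "2 * t - z \<le> 2 * t - x" "2 * t - x \<in> I2"
    using assms(3)[of z] by (auto simp: slice_def)
  then have "2 * t - z \<in> I2"
    using assms(1,2) mem_is_interval_1_I by blast
  then show "z \<in> slice I1 I2 t"
    using xz by (simp add: slice_def)
qed

lemma initial_in_slice:
  assumes "is_interval I2" "y \<in> I2" "\<And>x. x \<in> I1 \<Longrightarrow> 2 * t < x + y"
  shows "initial_in I1 (slice I1 I2 t)"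
  unfolding initial_in_def
proof (intro ballI impI)
  fix x z assume xz: "x \<in> slice I1 I2 t" "z \<in> I1" "z \<le> x"
  then have "2 * t - z \<le> y" "2 * t - x \<le> 2 * t - z" "2 * t - x \<in> I2"
    using assms(3)[of z] by (auto simp: slice_def)
  then have "2 * t - z \<in> I2"
    using assms(1,2) mem_is_interval_1_I by blast
  then show "z \<in> slice I1 I2 t"
    using xz by (simp add: slice_def)
qed

text \<open>Over \<open>x\<close> the line has height \<open>2 * t - x\<close>, which misses the
  interval \<open>I2\<close>; so \<open>I2\<close> lies entirely below or entirely above it.\<close>

lemma sums_one_side_of_line:
  assumes "is_interval I2" "x \<in> I1" "x \<notin> slice I1 I2 t"
  shows "(\<forall>y\<in>I2. x + y < 2 * t) \<or> (\<forall>y\<in>I2. 2 * t < x + y)"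
proof (rule ccontr)
  assume "\<not> ?thesis"
  then obtain y z where "y \<in> I2" "z \<in> I2" "2 * t - x \<le> y" "z \<le> 2 * t - x"
    by (auto simp: not_less algebra_simps)
  then have "2 * t - x \<in> I2"
    using assms(1) mem_is_interval_1_I by blast
  then show False
    using assms by (simp add: slice_def)
qed

text \<open>
  If neither projection of the segment is full, the segment cuts off a corner of the rectangle
  \<open>I1 \<times> I2\<close>, and that corner is the lower left or the upper right one.
\<close>

lemma slices_initial_or_final:
  assumes i: "is_interval I1" "is_interval I2"
    and ne: "slice I1 I2 t \<noteq> I1" "slice I2 I1 t \<noteq> I2"
  shows "initial_in I1 (slice I1 I2 t) \<and> initial_in I2 (slice I2 I1 t) \<or>
         final_in I1 (slice I1 I2 t) \<and> final_in I2 (slice I2 I1 t)"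
proof -
  obtain x y where x: "x \<in> I1" "x \<notin> slice I1 I2 t" and y: "y \<in> I2" "y \<notin> slice I2 I1 t"
    using ne slice_subset by blast
  have sx: "(\<forall>y\<in>I2. x + y < 2 * t) \<or> (\<forall>y\<in>I2. 2 * t < x + y)"
    using sums_one_side_of_line[OF i(2) x] .
  have sy: "(\<forall>x\<in>I1. y + x < 2 * t) \<or> (\<forall>x\<in>I1. 2 * t < y + x)"
    using sums_one_side_of_line[OF i(1) y] .
  show ?thesis
  \<comment> \<open>Both dichotomies \<open>sx\<close> and \<open>sy\<close> apply to the sum
    \<open>x + y\<close>, so the side of the line on which this one point lies decides them
    simultaneously.\<close>
  proof (cases "x + y < 2 * t")
    case True
    then have "\<forall>v\<in>I2. x + v < 2 * t" "\<forall>u\<in>I1. y + u < 2 * t"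
      using sx sy x y by (metis add.commute order.asym)+
    then show ?thesis
      using final_in_slice[OF i(2) y(1), of I1 t] final_in_slice[OF i(1) x(1), of I2 t]
      by (simp add: add.commute)
  next
    case False
    then have "\<forall>v\<in>I2. 2 * t < x + v" "\<forall>u\<in>I1. 2 * t < y + u"
      using sx sy x y by (metis add.commute)+
    then show ?thesis
      using initial_in_slice[OF i(2) y(1), of I1 t] initial_in_slice[OF i(1) x(1), of I2 t]
      by (simp add: add.commute)
  qed
qed

lemma initial_in_Union: "(\<And>U. U \<in> \<U> \<Longrightarrow> initial_in I U) \<Longrightarrow> initial_in I (\<Union>\<U>)"
  unfolding initial_in_def by blast

lemma final_in_Union: "(\<And>U. U \<in> \<U> \<Longrightarrow> final_in I U) \<Longrightarrow> final_in I (\<Union>\<U>)"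
  unfolding final_in_def by blast

text \<open>Of one point from each set, the smaller belongs to both. This forces the constants of
  all corners of one kind to agree.\<close>

lemma initial_in_meet:
  assumes "initial_in I U" "initial_in I U'" "U \<noteq> {}" "U' \<noteq> {}" "U \<subseteq> I" "U' \<subseteq> I"
  shows "U \<inter> U' \<noteq> {}"
  using assms unfolding initial_in_def by (meson disjoint_iff equals0I linear subset_iff)

lemma final_in_meet:
  assumes "final_in I U" "final_in I U'" "U \<noteq> {}" "U' \<noteq> {}" "U \<subseteq> I" "U' \<subseteq> I"
  shows "U \<inter> U' \<noteq> {}"
  using assms unfolding final_in_def by (meson disjoint_iff equals0I linear subset_iff)

section \<open>Enumeration of the components of an open set\<close>

lemma countable_enumeration_from_1:
  assumes "countable C" "C \<noteq> {}"
  obtains N :: enat and U :: "nat \<Rightarrow> 'a" where "1 \<le> N" "bij_betw U {n. 1 \<le> n \<and> enat n \<le> N} C"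
proof (cases "finite C")
  case True
  then obtain U where "bij_betw U {1..card C} C"
    using ex_bij_betw_nat_finite_1 by blast
  moreover have "{1..card C} = {n. 1 \<le> n \<and> enat n \<le> enat (card C)}"
    by auto
  moreover have "1 \<le> enat (card C)"
    using True assms by (simp add: one_enat_def Suc_leI card_gt_0_iff)
  ultimately show ?thesis
    using that[of "enat (card C)" U] by simp
next
  case False
  have "bij_betw (from_nat_into C) UNIV C"
    using assms(1) False by (rule bij_betw_from_nat_into)
  \<comment> \<open>The indices start at 1 but \<open>from_nat_into C\<close> starts at 0, hence the
    shift.\<close>
  moreover have "bij_betw (\<lambda>n. n - 1) {n. 1 \<le> n \<and> enat n \<le> \<infinity>} (UNIV :: nat set)"
    by (rule bij_betw_byWitness[where f' = Suc]) auto
  ultimately have "bij_betw (from_nat_into C \<circ> (\<lambda>n. n - 1)) {n. 1 \<le> n \<and> enat n \<le> \<infinity>} C"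
    using bij_betw_trans by blast
  then show ?thesis
    using that[of \<infinity>] by simp
qed

lemma open_real_set_components:
  fixes W :: "real set"
  assumes "open W" "W \<noteq> {}"
  obtains N :: enat and U :: "nat \<Rightarrow> real set" where "1 \<le> N"
    "\<And>n. n \<in> {n. 1 \<le> n \<and> enat n \<le> N} \<Longrightarrow> open_interval (U n) \<and> U n \<noteq> {}"
    "disjoint_family_on U {n. 1 \<le> n \<and> enat n \<le> N}"
    "(\<Union>n\<in>{n. 1 \<le> n \<and> enat n \<le> N}. U n) = W"
proof -
  have "countable (components W)"
    using assms(1) open_components pairwise_disjoint_components
    by (intro countable_disjoint_open_subsets) (blast, simp add: disjnt_def pairwise_def)
  then obtain N :: enat and U where U: "1 \<le> N" "bij_betw U {n. 1 \<le> n \<and> enat n \<le> N} (components W)"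
    using countable_enumeration_from_1[of "components W"] assms(2) by (metis components_eq_empty)
  let ?N = "{n. 1 \<le> n \<and> enat n \<le> N}"
  have mem: "U n \<in> components W" if "n \<in> ?N" for n
    using U(2) that bij_betwE by blast
  show ?thesis
  proof
    show "1 \<le> N" by fact
    show "open_interval (U n) \<and> U n \<noteq> {}" if "n \<in> ?N" for n
      using mem[OF that] assms(1)
      by (simp add: open_interval_def open_components is_interval_connected_1
          in_components_connected in_components_nonempty)
    show "disjoint_family_on U ?N"
      unfolding disjoint_family_on_def
    proof (intro ballI impI)
      fix m n assume mn: "m \<in> ?N" "n \<in> ?N" "m \<noteq> n"
      then have "U m \<noteq> U n"
        using U(2) by (meson bij_betw_imp_inj_on inj_onD)
      then show "U m \<inter> U n = {}"
        using components_nonoverlap mem mn by blast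
    qed
    show "(\<Union>n\<in>?N. U n) = W"
      using U(2) by (simp add: bij_betw_imp_surj_on Union_components[symmetric])
  qed
qed

section \<open>The alternative with one constant function\<close>

text \<open>A point of \<open>Ii\<close> outside \<open>V\<close> is a limit of points where
  \<open>\<psi>i\<close> differs from \<open>k\<close>. Sliding along the line of \<open>t\<close>
  to such a point while staying over \<open>Ij\<close> forces \<open>\<phi> t = 0\<close>. The set
  \<open>W\<close> makes \<open>V\<close> nonempty, as \<open>1 \<le> N\<close> demands, and
  \<open>x0\<close> keeps \<open>V\<close> from filling \<open>Ii\<close>.\<close>

lemma alternative3_atI:
  assumes Ij: "open Ij" "Ij \<noteq> {}" and j: "\<And>y. y \<in> Ij \<Longrightarrow> \<psi>j y = k"
    and Ii: "open Ii" and W: "open W" "W \<noteq> {}" "W \<subseteq> Ii" "\<And>x. x \<in> W \<Longrightarrow> \<psi>i x = k"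
    and nonconst: "x0 \<in> Ii" "\<psi>i x0 \<noteq> k"
    and eq: "\<And>x y. x \<in> Ii \<Longrightarrow> y \<in> Ij \<Longrightarrow> \<phi> ((x + y) / 2) * (\<psi>i x - \<psi>j y) = 0"
  shows "alternative3_at \<phi> Ij \<psi>j Ii \<psi>i"
proof -
  define G where "G = {x \<in> Ii. \<psi>i x \<noteq> k}"
  define V where "V = Ii - closure G"
  have "open V"
    unfolding V_def using Ii by auto
  have "W \<inter> G = {}"
    using W by (auto simp: G_def)
  then have "W \<subseteq> V"
    unfolding V_def using W open_Int_closure_eq_empty[of W G] by blast
  then have "V \<noteq> {}"
    using W by blast
  have x0: "x0 \<notin> V"
    using nonconst closure_subset[of G] by (auto simp: V_def G_def)
  have const: "\<psi>i x = k" if "x \<in> V" for x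
    using that closure_subset[of G] by (auto simp: V_def G_def)
  have zero: "\<phi> t = 0" if t: "t \<in> half_sum (Ii - V) Ij" for t
  proof -
    obtain x y where "x \<in> Ii" "x \<notin> V" "y \<in> Ij" "t = (x + y) / 2"
      using t by (auto simp: half_sum_def)
    moreover from this have "2 * t - x = y"
      by simp
    ultimately have xy: "x \<in> Ii" "x \<notin> V" "2 * t - x \<in> Ij"
      by simp_all
    have "open ((\<lambda>z. 2 * t - z) -` Ij)"
      using Ij by (intro open_vimage continuous_intros) auto
    moreover have "x \<in> (\<lambda>z. 2 * t - z) -` Ij \<inter> closure G"
      using xy by (auto simp: V_def)
    ultimately obtain z where z: "z \<in> G" "2 * t - z \<in> Ij"
      using open_Int_closure_eq_empty[of "(\<lambda>z. 2 * t - z) -` Ij" G] by blast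
    have "\<phi> ((z + (2 * t - z)) / 2) * (\<psi>i z - \<psi>j (2 * t - z)) = 0"
      using z by (intro eq) (auto simp: G_def)
    then show ?thesis
      using z j by (simp add: G_def)
  qed
  obtain N :: enat and U where U: "1 \<le> N"
    "\<And>n. n \<in> {n. 1 \<le> n \<and> enat n \<le> N} \<Longrightarrow> open_interval (U n) \<and> U n \<noteq> {}"
    "disjoint_family_on U {n. 1 \<le> n \<and> enat n \<le> N}"
    "(\<Union>n\<in>{n. 1 \<le> n \<and> enat n \<le> N}. U n) = V"
    using open_real_set_components[OF \<open>open V\<close> \<open>V \<noteq> {}\<close>] by blast
  show ?thesis
    unfolding alternative3_at_def Let_def
  proof (intro exI[of _ k] exI[of _ N] exI[of _ U] conjI)
    show "\<forall>n\<in>{n. 1 \<le> n \<and> enat n \<le> N}. open_interval (U n) \<and> U n \<noteq> {} \<and> U n \<subseteq> Ii"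
      using U(2,4) V_def by blast
    show "(\<Union>n\<in>{n. 1 \<le> n \<and> enat n \<le> N}. U n) \<noteq> Ii"
      unfolding U(4) using x0 nonconst by blast
  qed (use U j const zero in \<open>simp_all only: U(4)\<close>, auto)
qed

text \<open>
  When the segments through the essential support project onto all of one interval, connectedness
  makes the function there constant.
\<close>

lemma slices_cover:
  fixes \<psi>1 \<psi>2 :: "real \<Rightarrow> real"
  assumes I1: "open_interval I1" and I2: "open_interval I2"
    and cover: "I1 \<subseteq> (\<Union>t\<in>D. slice I1 I2 t)" and D: "t0 \<in> D" "slice I1 I2 t0 \<noteq> {}"
    and c1: "\<And>t x. t \<in> D \<Longrightarrow> x \<in> slice I1 I2 t \<Longrightarrow> \<psi>1 x = c t"
    and c2: "\<And>t y. t \<in> D \<Longrightarrow> y \<in> slice I2 I1 t \<Longrightarrow> \<psi>2 y = c t"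
    and eq: "\<And>x y. x \<in> I2 \<Longrightarrow> y \<in> I1 \<Longrightarrow> \<phi> ((x + y) / 2) * (\<psi>2 x - \<psi>1 y) = 0"
  shows "(\<exists>k. \<forall>x\<in>I1. \<forall>y\<in>I2. \<psi>1 x = k \<and> \<psi>2 y = k) \<or> alternative3_at \<phi> I1 \<psi>1 I2 \<psi>2"
proof -
  have o: "open I1" "open I2" and conn: "connected I1"
    using I1 I2 by (auto simp: open_interval_def is_interval_connected_1)
  obtain p where p: "p \<in> slice I1 I2 t0"
    using D by blast
  then have pI: "p \<in> I1"
    using slice_subset by blast
  have const: "\<psi>1 x = c t0" if "x \<in> I1" for x
  proof -
    have "\<psi>1 x = \<psi>1 p"
    proof (rule connected_local_const[OF conn that pI], rule ballI)
      fix a assume "a \<in> I1"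
      then obtain t where t: "t \<in> D" "a \<in> slice I1 I2 t"
        using cover by blast
      then have "\<forall>\<^sub>F b in at a within I1. b \<in> slice I1 I2 t"
        by (intro eventually_at_in_open' open_slice o filter_leD[OF at_le[of I1 UNIV]]) auto
      then show "\<forall>\<^sub>F b in at a within I1. \<psi>1 a = \<psi>1 b"
        by eventually_elim (simp add: c1[OF t] c1[OF t(1)])
    qed
    then show ?thesis
      using c1 D p by simp
  qed
  show ?thesis
  proof (cases "\<forall>y\<in>I2. \<psi>2 y = c t0")
    case True
    then show ?thesis
      using const by blast
  next
    case False
    then obtain x0 where x0: "x0 \<in> I2" "\<psi>2 x0 \<noteq> c t0"
      by blast
    have "alternative3_at \<phi> I1 \<psi>1 I2 \<psi>2"
    \<comment> \<open>The projection of a single segment already provides a nonempty open set on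
      which \<psi>2 has the right value.\<close>
    proof (rule alternative3_atI[where W = "slice I2 I1 t0" and k = "c t0"])
      show "slice I2 I1 t0 \<noteq> {}"
        using mem_slice_swap[OF p] by blast
      show "I1 \<noteq> {}"
        using pI by blast
      show "\<And>x. x \<in> slice I2 I1 t0 \<Longrightarrow> \<psi>2 x = c t0"
        by (rule c2[OF D(1)])
    qed (fact o const x0 eq slice_subset open_slice[OF o(2,1)])+
    then show ?thesis ..
  qed
qed

section \<open>Case distinction by the projections of the segments\<close>

theorem theorem2:
  fixes I1 I2 :: "real set" and \<phi> \<psi>1 \<psi>2 :: "real \<Rightarrow> real"
  assumes "open_interval I1" and "I1 \<noteq> {}"
    and "open_interval I2" and "I2 \<noteq> {}"
    and "\<And>x y. x \<in> I1 \<Longrightarrow> y \<in> I2 \<Longrightarrow> \<phi> ((x + y) / 2) * (\<psi>1 x - \<psi>2 y) = 0"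
    and "\<phi> \<in> borel_measurable (lebesgue_on (half_sum I1 I2))"
  shows "alternative1 I1 I2 \<phi> \<psi>1 \<psi>2 \<or> alternative2 I1 I2 \<phi> \<psi>1 \<psi>2 \<or> alternative3 I1 I2 \<phi> \<psi>1 \<psi>2"
proof -
  note eq = assms(5)
  have eq': "\<phi> ((y + x) / 2) * (\<psi>2 y - \<psi>1 x) = 0" if "y \<in> I2" "x \<in> I1" for x y
    using eq[OF that(2,1)] by (auto simp: add.commute)
  have o: "open I1" "open I2" and i: "is_interval I1" "is_interval I2"
    using assms by (auto simp: open_interval_def)
  define J where "J = half_sum I1 I2"
  define E where "E = supp_on J \<phi>"
  \<comment> \<open>The essential support can contain boundary points of \<open>J\<close>, whose
    slices are empty; intersecting with \<open>J\<close> removes them and loses nothing of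
    \<open>E\<close>.\<close>
  define D where "D = J \<inter> essential_supp E"
  have "J \<in> sets lebesgue"
    unfolding J_def using open_half_sum[OF o(1)] by (simp add: borel_open)
  moreover have "E = \<phi> -` (- {0}) \<inter> space (lebesgue_on J)"
    by (auto simp: E_def supp_on_def space_restrict_space)
  then have "E \<in> sets (lebesgue_on J)"
    using measurable_sets[OF assms(6), of "- {0}"] by (simp add: J_def)
  ultimately have E: "E \<in> sets lebesgue"
    by (simp add: sets_restrict_space_iff)
  have null: "E - D \<in> null_sets lebesgue"
    using null_outside_essential_supp[of E] by (simp add: D_def E_def supp_on_def Diff_Int_distrib
        Diff_eq Collect_conj_eq Int_ac Int_Un_distrib)
  have eqE: "\<psi>1 x = \<psi>2 (2 * u - x)" if "u \<in> E" "x \<in> slice I1 I2 u" for u x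
    using eq[of x "2 * u - x"] that by (auto simp: E_def supp_on_def slice_def)
  have "\<exists>k. (\<forall>x\<in>slice I1 I2 t. \<psi>1 x = k) \<and> (\<forall>y\<in>slice I2 I1 t. \<psi>2 y = k)" if "t \<in> D" for t
    using that by (intro const_on_slices[OF E _ assms(1,3)] eqE) (simp add: D_def)
  then obtain c where c1: "\<And>t x. t \<in> D \<Longrightarrow> x \<in> slice I1 I2 t \<Longrightarrow> \<psi>1 x = c t"
    and c2: "\<And>t y. t \<in> D \<Longrightarrow> y \<in> slice I2 I1 t \<Longrightarrow> \<psi>2 y = c t"
    by metis
  have ne1: "slice I1 I2 t \<noteq> {}" and ne2: "slice I2 I1 t \<noteq> {}" if "t \<in> D" for t
    using that by (simp_all add: slice_eq_empty_iff D_def J_def half_sum_commute[of I2])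
  show ?thesis
  proof (cases "D = {}")
    case True
    then show ?thesis
      using null by (simp add: alternative1_def E_def J_def)
  next
    case False
    then obtain t0 where t0: "t0 \<in> D"
      by blast
    show ?thesis
    proof (cases "I1 \<subseteq> (\<Union>t\<in>D. slice I1 I2 t) \<or> I2 \<subseteq> (\<Union>t\<in>D. slice I2 I1 t)")
      case True
      then show ?thesis
      proof
        assume "I1 \<subseteq> (\<Union>t\<in>D. slice I1 I2 t)"
        from assms(1,3) this t0 ne1[OF t0] c1 c2 eq'
        have "(\<exists>k. \<forall>x\<in>I1. \<forall>y\<in>I2. \<psi>1 x = k \<and> \<psi>2 y = k) \<or> alternative3_at \<phi> I1 \<psi>1 I2 \<psi>2"
          by (rule slices_cover)
        then show ?thesis
          by (auto simp: alternative1_def alternative3_def)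
      next
        assume "I2 \<subseteq> (\<Union>t\<in>D. slice I2 I1 t)"
        from assms(3,1) this t0 ne2[OF t0] c2 c1 eq
        have "(\<exists>k. \<forall>y\<in>I2. \<forall>x\<in>I1. \<psi>2 y = k \<and> \<psi>1 x = k) \<or> alternative3_at \<phi> I2 \<psi>2 I1 \<psi>1"
          by (rule slices_cover)
        then show ?thesis
          by (auto simp: alternative1_def alternative3_def)
      qed
    next
      case False
      \<comment> \<open>\<open>DL\<close> collects the lines cutting off a lower left corner of the
        rectangle, \<open>DR\<close> those cutting off an upper right one. No single slice is full
        here, since it would cover its interval alone.\<close>
      define DL where "DL = {t \<in> D. initial_in I1 (slice I1 I2 t) \<and> initial_in I2 (slice I2 I1 t)}"
      define DR where "DR = {t \<in> D. final_in I1 (slice I1 I2 t) \<and> final_in I2 (slice I2 I1 t)}"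
      have D: "D = DL \<union> DR"
      proof -
        have "t \<in> DL \<union> DR" if t: "t \<in> D" for t
          using slices_initial_or_final[OF i, of t] False t unfolding DL_def DR_def by blast
        then show ?thesis
          unfolding DL_def DR_def by blast
      qed
      have sub: "t \<in> DL \<Longrightarrow> t \<in> D" "t \<in> DR \<Longrightarrow> t \<in> D" for t
        using D by auto
      have "c t = c s" if ts: "t \<in> DL" "s \<in> DL" for t s
      proof -
        have "slice I1 I2 t \<inter> slice I1 I2 s \<noteq> {}"
          using ts ne1 by (intro initial_in_meet[of I1]) (auto simp: DL_def subsetD[OF slice_subset])
        then show ?thesis
          using c1 sub ts by (metis disjoint_iff)
      qed
      \<comment> \<open>If \<open>DL\<close> is empty, any \<open>k\<close> will do, and
        \<open>U1\<close> and \<open>U2\<close> are empty as well.\<close>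
      then obtain k where k: "\<And>t. t \<in> DL \<Longrightarrow> c t = k"
        by metis
      have "c t = c s" if ts: "t \<in> DR" "s \<in> DR" for t s
      proof -
        have "slice I1 I2 t \<inter> slice I1 I2 s \<noteq> {}"
          using ts ne1 by (intro final_in_meet[of I1]) (auto simp: DR_def subsetD[OF slice_subset])
        then show ?thesis
          using c1 sub ts by (metis disjoint_iff)
      qed
      then obtain n where n: "\<And>t. t \<in> DR \<Longrightarrow> c t = n"
        by metis
      define U1 where "U1 = (\<Union>t\<in>DL. slice I1 I2 t)"
      define U2 where "U2 = (\<Union>t\<in>DL. slice I2 I1 t)"
      define V1 where "V1 = (\<Union>t\<in>DR. slice I1 I2 t)"
      define V2 where "V2 = (\<Union>t\<in>DR. slice I2 I1 t)"
      note UV_defs = U1_def U2_def V1_def V2_def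
      have opens: "open U1" "open U2" "open V1" "open V2"
        unfolding UV_defs using o by (auto intro: open_slice)
      have subs: "U1 \<subseteq> I1" "U2 \<subseteq> I2" "V1 \<subseteq> I1" "V2 \<subseteq> I2"
        unfolding UV_defs by (auto simp: slice_def)
      have ends: "initial_in I1 U1" "initial_in I2 U2" "final_in I1 V1" "final_in I2 V2"
        unfolding UV_defs by (auto intro!: initial_in_Union final_in_Union simp: DL_def DR_def)
      have K: "I1 - (U1 \<union> V1) \<noteq> {}" "I2 - (U2 \<union> V2) \<noteq> {}"
        using False unfolding UV_defs D by blast+
      obtain a1 b1 where ab1: "einf I1 \<le> a1" "a1 \<le> b1" "b1 \<le> esup I1"
        "ioo (einf I1) a1 = U1" "ioo b1 (esup I1) = V1"
        "is_interval (I1 - (U1 \<union> V1))" "closedin (top_of_set I1) (I1 - (U1 \<union> V1))"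
        using two_ended_complement[OF assms(1,2) opens(1) subs(1) ends(1) opens(3) subs(3) ends(3) K(1)] .
      obtain a2 b2 where ab2: "einf I2 \<le> a2" "a2 \<le> b2" "b2 \<le> esup I2"
        "ioo (einf I2) a2 = U2" "ioo b2 (esup I2) = V2"
        "is_interval (I2 - (U2 \<union> V2))" "closedin (top_of_set I2) (I2 - (U2 \<union> V2))"
        using two_ended_complement[OF assms(3,4) opens(2) subs(2) ends(2) opens(4) subs(4) ends(4) K(2)] .
      have proper: "U1 \<noteq> I1" "V1 \<noteq> I1" "U2 \<noteq> I2" "V2 \<noteq> I2"
        using K by blast+
      have nonempty: "U1 \<noteq> {} \<and> U2 \<noteq> {} \<or> V1 \<noteq> {} \<and> V2 \<noteq> {}"
        using t0 D ne1[OF t0] ne2[OF t0] unfolding UV_defs by blast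
      have U1k: "\<psi>1 x = k" if "x \<in> U1" for x
        using that c1[OF sub(1)] k unfolding U1_def by (metis UN_E)
      have U2k: "\<psi>2 y = k" if "y \<in> U2" for y
        using that c2[OF sub(1)] k unfolding U2_def by (metis UN_E)
      have V1n: "\<psi>1 x = n" if "x \<in> V1" for x
        using that c1[OF sub(2)] n unfolding V1_def by (metis UN_E)
      have V2n: "\<psi>2 y = n" if "y \<in> V2" for y
        using that c2[OF sub(2)] n unfolding V2_def by (metis UN_E)
      \<comment> \<open>A midpoint in \<open>D\<close> puts \<open>x\<close> and \<open>y\<close>
        into the slices of its own line, hence outside both remainders. So \<open>?H\<close> avoids
        \<open>D\<close> and meets \<open>E\<close> only in the null set
        \<open>E - D\<close>.\<close>
      let ?H = "half_sum (I1 - (U1 \<union> V1)) I2 \<union> half_sum I1 (I2 - (U2 \<union> V2))"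
      have "x \<in> U1 \<union> V1" "y \<in> U2 \<union> V2" if "x \<in> I1" "y \<in> I2" "(x + y) / 2 \<in> D" for x y
        using mem_slice_midpoint[OF that(1,2)] that(3) unfolding UV_defs D by blast+
      then have "?H \<inter> D = {}"
        unfolding half_sum_def by blast
      then have "?H \<inter> E \<subseteq> E - D"
        by blast
      then have H: "?H \<inter> supp_on (half_sum I1 I2) \<phi> \<in> null_sets lebesgue"
        using null unfolding E_def J_def by (meson negligible_iff_null_sets negligible_subset)
      have "alternative2 I1 I2 \<phi> \<psi>1 \<psi>2"
        unfolding alternative2_def Let_def
        by (rule exI[of _ k], rule exI[of _ n], rule exI[of _ a1], rule exI[of _ b1],
            rule exI[of _ a2], rule exI[of _ b2], unfold ab1(4,5) ab2(4,5))
          (intro conjI ballI ab1 ab2 proper K nonempty U1k U2k V1n V2n H; assumption)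
      then show ?thesis
        by blast
    qed
  qed
qed

end
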